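(* There exist constants $\widetilde C_1,\widetilde C_2$ depending only on $[a,b]$ and on the underlying norm in $\mathbb{R}^d$ such that the following holds. Let $T_n$ be an integral operator $T_nf(x)=\int_a^b\mathcal{K}_n(x,t)f(t)\,dt$, with $\mathcal{K}_n\in C([a,b]^2)$, which is positive (i.e. $T_nf\ge0$ whenever $f\ge0$) and satisfies $\|T_ng\|_{L^1}\le\|g\|_{L^1}$ for every (real-valued) $g\in L^1[a,b]$, and let $F\in\mathcal{F}[a,b]$. Put $\lambda_n=\big(\max_{i=0,1}\|T_ne_i-e_i\|_{L^1}\big)^{1/2}$, where $e_i(x)=x^i$. Then $$\mathrm{haus}\big(\mathcal{S}(F),T_n\mathcal{S}(F)\big)\le\widetilde C_1\Big(\lambda_n^2\sup_{s\in\mathcal{S}(F)}\|s\|_{L^1}+2\lambda_nV_a^b(F)\Big)\le\widetilde C_1\Big(\lambda_n^2\|F\|_\infty(b-a)+2\lambda_nV_a^b(F)\Big).$$ If, in addition, $T_ne_0\equiv e_0$, then $$\mathrm{haus}\big(\mathcal{S}(F),T_n\mathcal{S}(F)\big)\le\widetilde C_2\big(\lambda_n^2(b-a)+2\lambda_n\big)V_a^b(F).$$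
   Context: Fix a norm $|\cdot|$ on $\mathbb{R}^d$ and $[a,b]\subset\mathbb{R}$. $\mathrm{K}(\mathbb{R}^d)$ is the collection of non-empty compact subsets of $\mathbb{R}^d$ with the Hausdorff metric $\mathrm{haus}$ induced by $|\cdot|$; $|A|=\mathrm{haus}(A,\{0\})$. Metric pairs and chains: for $A,B\in\mathrm{K}(\mathbb{R}^d)$ and $y\in\mathbb{R}^d$, $\Pi_B(y)=\{b\in B: |y-b|=\mathrm{dist}(y,B)\}$ and $\Pi(A,B)=\{(p,q)\in A\times B: p\in\Pi_A(q)\text{ or }q\in\Pi_B(p)\}$. $\mathrm{CH}(A_0,\dots,A_n)=\{(y_0,\dots,y_n): (y_i,y_{i+1})\in\Pi(A_i,A_{i+1}),\ i=0,\dots,n-1\}$ is the set of metric chains. Variation: for $F:[a,b]\to \mathrm{K}(\mathbb{R}^d)$, $V_a^b(F)=\sup\sum_i \mathrm{haus}(F(x_i),F(x_{i-1}))$ over all partitions of $[a,b]$; $F$ is of bounded variation if $V_a^b(F)<\infty$. $\|F\|_\infty=\sup_{x\in[a,b]}|F(x)|$. $\mathcal{F}[a,b]$ is the class of all $F:[a,b]\to\mathrm{K}(\mathbb{R}^d)$ of bounded variation whose graph $\{(x,y): x\in[a,b],\ y\in F(x)\}$ is compact. Metric selections: for a partition $\chi=\{a=x_0<\dots<x_n=b\}$ with $|\chi|=\max_i(x_{i+1}-x_i)$ and $\phi=(y_0,\dots,y_n)\in\mathrm{CH}(F(x_0),\dots,F(x_n))$, the chain function is $c_{\chi,\phi}(x)=y_i$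 for $x\in[x_i,x_{i+1})$, $i=0,\dots,n-1$, and $c_{\chi,\phi}(x_n)=y_n$. A function $s:[a,b]\to\mathbb{R}^d$ with $s(x)\in F(x)$ for all $x$ is a metric selection of $F$ if it is the pointwise limit on $[a,b]$ of a sequence of chain functions $c_{\chi_k,\phi_k}$ of $F$ with $|\chi_k|\to0$. $\mathcal{S}(F)$ is the set of all metric selections of $F$; its elements are of bounded variation, hence lie in $L^1[a,b]$. For $\mathbb{R}^d$-valued $f$, $T_nf$ is obtained by applying $T_n$ to each component, and $\|f\|_{L^1}=\int_a^b|f(x)|\,dx$. $T_n\mathcal{S}(F)=\{T_ns: s\in\mathcal{S}(F)\}$. The Hausdorff distance between the two sets of functions is taken in $L^1$: $$\mathrm{haus}(\mathcal{S}(F),T_n\mathcal{S}(F))=\max\Big\{\sup_{\sigma\in T_n\mathcal{S}(F)}\inf_{s\in\mathcal{S}(F)}\|s-\sigma\|_{L^1},\ \sup_{s\in\mathcal{S}(F)}\inf_{\sigma\in T_n\mathcal{S}(F)}\|s-\sigma\|_{L^1}\Big\}.$$ *)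

theory Defs
  imports "HOL-Analysis.Analysis"
begin

text \<open>An arbitrary norm on a real vector space (not necessarily the norm of the type class);
  nonnegativity follows.\<close>

definition is_norm :: "('v::real_vector \<Rightarrow> real) \<Rightarrow> bool" where
  "is_norm N \<longleftrightarrow>
     (\<forall>v. N v = 0 \<longleftrightarrow> v = 0) \<and>
     (\<forall>c v. N (c *\<^sub>R v) = \<bar>c\<bar> * N v) \<and>
     (\<forall>v w. N (v + w) \<le> N v + N w)"

text \<open>Hausdorff distances, suprema of norms and variations take values in \<open>[0, \<infinity>]\<close>, so that every
  supremum and infimum is the genuine one, without a side condition of boundedness.\<close>

definition hausdorff :: "('v \<Rightarrow> 'v \<Rightarrow> real) \<Rightarrow> 'v set \<Rightarrow> 'v set \<Rightarrow> ennreal" where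
  "hausdorff d A B =
     max (SUP x\<in>A. INF y\<in>B. ennreal (d x y)) (SUP y\<in>B. INF x\<in>A. ennreal (d x y))"

definition haus :: "('v::real_vector \<Rightarrow> real) \<Rightarrow> 'v set \<Rightarrow> 'v set \<Rightarrow> ennreal" where
  "haus N A B = hausdorff (\<lambda>x y. N (x - y)) A B"

definition set_norm :: "('v::real_vector \<Rightarrow> real) \<Rightarrow> 'v set \<Rightarrow> ennreal" where
  "set_norm N A = haus N A {0}"

definition metric_proj :: "('v::real_vector \<Rightarrow> real) \<Rightarrow> 'v set \<Rightarrow> 'v \<Rightarrow> 'v set" where
  "metric_proj N B y = {b \<in> B. N (y - b) = (INF b'\<in>B. N (y - b'))}"

definition metric_pairs :: "('v::real_vector \<Rightarrow> real) \<Rightarrow> 'v set \<Rightarrow> 'v set \<Rightarrow> ('v \<times> 'v) set" where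
  "metric_pairs N A B =
     {(p, q). p \<in> A \<and> q \<in> B \<and> (p \<in> metric_proj N A q \<or> q \<in> metric_proj N B p)}"

text \<open>Tuples \<open>(y\<^sub>0, \<dots>, y\<^sub>n)\<close> are functions on \<^typ>\<open>nat\<close>, of which only the values at
  \<open>0, \<dots>, n\<close> matter.\<close>

definition metric_chains ::
  "('v::real_vector \<Rightarrow> real) \<Rightarrow> nat \<Rightarrow> (nat \<Rightarrow> 'v set) \<Rightarrow> (nat \<Rightarrow> 'v) set" where
  "metric_chains N n A = {y. \<forall>i<n. (y i, y (Suc i)) \<in> metric_pairs N (A i) (A (Suc i))}"

definition is_partition :: "real \<Rightarrow> real \<Rightarrow> nat \<Rightarrow> (nat \<Rightarrow> real) \<Rightarrow> bool" where
  "is_partition a b n x \<longleftrightarrow> x 0 = a \<and> x n = b \<and> (\<forall>i<n. x i < x (Suc i))"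

definition mesh :: "nat \<Rightarrow> (nat \<Rightarrow> real) \<Rightarrow> real" where
  "mesh n x = (MAX i\<in>{..<n}. x (Suc i) - x i)"

definition variation ::
  "('v::real_vector \<Rightarrow> real) \<Rightarrow> real \<Rightarrow> real \<Rightarrow> (real \<Rightarrow> 'v set) \<Rightarrow> ennreal" where
  "variation N a b F =
     (SUP (n, x)\<in>{(n, x). is_partition a b n x}. \<Sum>i=1..n. haus N (F (x i)) (F (x (i - 1))))"

definition sup_norm ::
  "('v::real_vector \<Rightarrow> real) \<Rightarrow> real \<Rightarrow> real \<Rightarrow> (real \<Rightarrow> 'v set) \<Rightarrow> ennreal" where
  "sup_norm N a b F = (SUP x\<in>{a..b}. set_norm N (F x))"

text \<open>The class \<open>\<F>[a,b]\<close>. Functions on \<open>[a,b]\<close> are total functions whose values outside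
  \<open>[a,b]\<close> are irrelevant. Compactness refers to the Euclidean topology, which is the topology
  of every norm on \<open>\<real>\<^sup>d\<close>.\<close>

definition BV_compact_graph ::
  "(real^'d \<Rightarrow> real) \<Rightarrow> real \<Rightarrow> real \<Rightarrow> (real \<Rightarrow> (real^'d) set) set" where
  "BV_compact_graph N a b =
     {F. (\<forall>x\<in>{a..b}. F x \<noteq> {} \<and> compact (F x)) \<and>
         variation N a b F < \<infinity> \<and>
         compact {(x, y). x \<in> {a..b} \<and> y \<in> F x}}"

definition chain_fun :: "nat \<Rightarrow> (nat \<Rightarrow> real) \<Rightarrow> (nat \<Rightarrow> 'v) \<Rightarrow> real \<Rightarrow> 'v" where
  "chain_fun n x y t =
     (if t = x n then y n else y (THE i. i < n \<and> x i \<le> t \<and> t < x (Suc i)))"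

definition metric_selections ::
  "(real^'d \<Rightarrow> real) \<Rightarrow> real \<Rightarrow> real \<Rightarrow> (real \<Rightarrow> (real^'d) set) \<Rightarrow> (real \<Rightarrow> real^'d) set" where
  "metric_selections N a b F =
     {s. (\<forall>t\<in>{a..b}. s t \<in> F t) \<and>
         (\<exists>n x y. (\<forall>k. is_partition a b (n k) (x k) \<and>
                       y k \<in> metric_chains N (n k) (\<lambda>i. F (x k i))) \<and>
                  (\<lambda>k. mesh (n k) (x k)) \<longlonglongrightarrow> 0 \<and>
                  (\<forall>t\<in>{a..b}. (\<lambda>k. chain_fun (n k) (x k) (y k) t) \<longlonglongrightarrow> s t))}"

text \<open>The \<open>L\<^sup>1\<close> norm on \<open>[a,b]\<close>; it is only ever applied to Lebesgue integrable functions. For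
  real-valued functions \<open>N\<close> is \<^const>\<open>abs\<close>.\<close>

definition L1_norm :: "('v \<Rightarrow> real) \<Rightarrow> real \<Rightarrow> real \<Rightarrow> (real \<Rightarrow> 'v) \<Rightarrow> real" where
  "L1_norm N a b f = (LINT t:{a..b}|lebesgue. N (f t))"

definition haus_L1 ::
  "('v::real_vector \<Rightarrow> real) \<Rightarrow> real \<Rightarrow> real \<Rightarrow> (real \<Rightarrow> 'v) set \<Rightarrow> (real \<Rightarrow> 'v) set \<Rightarrow> ennreal" where
  "haus_L1 N a b S S' = hausdorff (\<lambda>s \<sigma>. L1_norm N a b (\<lambda>t. s t - \<sigma> t)) S S'"

definition int_op ::
  "real \<Rightarrow> real \<Rightarrow> (real \<Rightarrow> real \<Rightarrow> real) \<Rightarrow> (real \<Rightarrow> real) \<Rightarrow> real \<Rightarrow> real" where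
  "int_op a b K f x = (LINT t:{a..b}|lebesgue. K x t * f t)"

definition int_op_vec ::
  "real \<Rightarrow> real \<Rightarrow> (real \<Rightarrow> real \<Rightarrow> real) \<Rightarrow> (real \<Rightarrow> real^'d) \<Rightarrow> real \<Rightarrow> real^'d" where
  "int_op_vec a b K f x = (\<chi> i. int_op a b K (\<lambda>t. f t $ i) x)"

definition positive_op :: "real \<Rightarrow> real \<Rightarrow> ((real \<Rightarrow> real) \<Rightarrow> real \<Rightarrow> real) \<Rightarrow> bool" where
  "positive_op a b T \<longleftrightarrow>
     (\<forall>f. f absolutely_integrable_on {a..b} \<longrightarrow> (\<forall>t\<in>{a..b}. 0 \<le> f t) \<longrightarrow> (\<forall>x\<in>{a..b}. 0 \<le> T f x))"

definition L1_contraction :: "real \<Rightarrow> real \<Rightarrow> ((real \<Rightarrow> real) \<Rightarrow> real \<Rightarrow> real) \<Rightarrow> bool" where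
  "L1_contraction a b T \<longleftrightarrow>
     (\<forall>g. g absolutely_integrable_on {a..b} \<longrightarrow> L1_norm abs a b (T g) \<le> L1_norm abs a b g)"

definition lam :: "real \<Rightarrow> real \<Rightarrow> ((real \<Rightarrow> real) \<Rightarrow> real \<Rightarrow> real) \<Rightarrow> real" where
  "lam a b T = sqrt (MAX i\<in>{0, 1::nat}. L1_norm abs a b (\<lambda>x. T (\<lambda>t. t ^ i) x - x ^ i))"

end

theory Submission
  imports Defs
begin

text \<open>A chain function is a step function \<open>y\<^sub>0 + \<Sum>i (y\<^sub>i\<^sub>+\<^sub>1 - y\<^sub>i) h\<^sub>i\<close> with
  \<open>h\<^sub>i\<close> the indicator of a half-line, and \<open>\<Sum>i N (y\<^sub>i\<^sub>+\<^sub>1 - y\<^sub>i)\<close> is at most the variation of \<open>F\<close>.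
  By linearity it suffices to bound \<open>T h - h\<close> in \<open>L\<^sup>1\<close> for such indicators. Positivity and
  contraction give \<open>O(\<lambda>\<^sup>2)\<close> for the truncated powers \<open>\<phi>\<^sub>u(t) = max 0 (t - u)\<close>. Since \<open>h\<close> is
  within \<open>\<delta>\<close> of \<open>(\<phi>\<^sub>u - \<phi>\<^sub>u\<^sub>+\<^sub>\<delta>) / \<delta>\<close>, the choice \<open>\<delta> = \<lambda>\<close> gives \<open>O(\<lambda>)\<close> for \<open>h\<close>.
  Dominated convergence passes from chain functions to metric selections \<open>s\<close>, and the Hausdorff
  distance is at most the supremum of the distances from \<open>s\<close> to \<open>T s\<close>.\<close>

section \<open>Integration over a compact interval\<close>

lemma L1_norm_eq: "L1_norm N a b f = integral\<^sup>L (lebesgue_on {a..b}) (\<lambda>t. N (f t))"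
  by (simp add: L1_norm_def set_lebesgue_integral_def integral_restrict_space)

lemma int_op_eq: "int_op a b K f x = integral\<^sup>L (lebesgue_on {a..b}) (\<lambda>t. K x t * f t)"
  by (simp add: int_op_def set_lebesgue_integral_def integral_restrict_space)

lemma absolutely_integrable_eq:
  fixes f :: "real \<Rightarrow> 'v::euclidean_space"
  shows "f absolutely_integrable_on {a..b} \<longleftrightarrow> integrable (lebesgue_on {a..b}) f"
  by (simp add: set_integrable_def integrable_restrict_space)

lemma finite_measure_interval: "finite_measure (lebesgue_on {a..b::real})"
  by (rule finite_measureI) (simp add: emeasure_restrict_space emeasure_lborel_Icc_eq)

lemma integrable_bounded_interval:
  fixes f :: "real \<Rightarrow> 'v::euclidean_space"
  assumes "f \<in> borel_measurable (lebesgue_on {a..b})" "\<And>t. t \<in> {a..b} \<Longrightarrow> norm (f t) \<le> B"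
  shows "integrable (lebesgue_on {a..b}) f"
  by (rule finite_measure.integrable_const_bound[OF finite_measure_interval, where B=B])
     (use assms in \<open>auto simp: AE_restrict_space_iff\<close>)

lemma borel_measurable_interval:
  "f \<in> borel_measurable borel \<Longrightarrow> f \<in> borel_measurable (lebesgue_on {a..b::real})"
  by (intro measurable_restrict_space1) (simp add: measurable_completion)

lemma L1_norm_mono:
  assumes "integrable (lebesgue_on {a..b}) (\<lambda>t. N (f t))" "integrable (lebesgue_on {a..b}) g"
    "\<And>t. t \<in> {a..b} \<Longrightarrow> N (f t) \<le> g t"
  shows "L1_norm N a b f \<le> integral\<^sup>L (lebesgue_on {a..b}) g"
  unfolding L1_norm_eq by (rule integral_mono) (use assms in auto)

lemma L1_norm_cong:
  assumes "\<And>t. t \<in> {a..b} \<Longrightarrow> f t = g t"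
  shows "L1_norm N a b f = L1_norm N a b g"
  unfolding L1_norm_eq by (rule Bochner_Integration.integral_cong) (use assms in auto)

lemma measure_interval [simp]:
  "a \<le> b \<Longrightarrow> measure (lebesgue_on {a..b::real}) {a..b} = b - a"
  by (simp add: measure_restrict_space)

lemma L1_norm_abs_nonneg: "0 \<le> L1_norm abs a b f"
  by (simp add: L1_norm_eq)

section \<open>Arbitrary norms\<close>

lemma is_normD:
  assumes "is_norm N"
  shows "N 0 = 0" "N (c *\<^sub>R v) = \<bar>c\<bar> * N v" "N (v + w) \<le> N v + N w"
  using assms by (auto simp: is_norm_def)

lemma is_norm_minus: "is_norm N \<Longrightarrow> N (- v) = N v"
  using is_normD(2)[of N "-1" v] by simp

lemma is_norm_minus_commute: "is_norm N \<Longrightarrow> N (v - w) = N (w - v)"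
  by (metis is_norm_minus minus_diff_eq)

lemma is_norm_nonneg: "is_norm N \<Longrightarrow> 0 \<le> N v"
  using is_normD(3)[of N v "-v"] is_normD(1)[of N] is_norm_minus[of N v] by simp

lemma is_norm_sum: "is_norm N \<Longrightarrow> N (sum f I) \<le> (\<Sum>i\<in>I. N (f i))"
proof (induction I rule: infinite_finite_induct)
  case (insert i I)
  then show ?case using is_normD(3)[of N "f i" "sum f I"] by simp
qed (simp_all add: is_normD)

text \<open>Homogeneity and the triangle inequality make \<open>N\<close> convex, and a convex
  function on a finite-dimensional space is continuous. This ties \<open>N\<close> to the Euclidean
  topology in which limits and measurability are taken.\<close>

lemma is_norm_continuous:
  fixes N :: "'v::euclidean_space \<Rightarrow> real"
  assumes "is_norm N"
  shows "continuous_on UNIV N"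
proof (rule convex_on_continuous)
  show "convex_on UNIV N"
  proof (rule convex_onI)
    fix t :: real and x y :: 'v
    assume "0 < t" "t < 1"
    then show "N ((1 - t) *\<^sub>R x + t *\<^sub>R y) \<le> (1 - t) * N x + t * N y"
      using is_normD(3)[OF assms, of "(1 - t) *\<^sub>R x" "t *\<^sub>R y"] is_normD(2)[OF assms] by simp
  qed simp
qed simp

text \<open>A continuous function is bounded on a compact ball. The bound \<open>B\<close> serves
  integrability and dominated convergence; it does not enter the final constants.\<close>

lemma is_norm_bounded:
  fixes N :: "'v::euclidean_space \<Rightarrow> real"
  assumes "is_norm N"
  obtains B where "0 \<le> B" "\<And>v. norm v \<le> R \<Longrightarrow> N v \<le> B"
proof -
  have "compact (N ` cball 0 R)"
    by (intro compact_continuous_image continuous_on_subset[OF is_norm_continuous[OF assms]]) auto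
  then obtain B where "\<forall>x\<in>N ` cball 0 R. norm x \<le> B"
    using compact_imp_bounded bounded_iff by metis
  then have "N v \<le> max 0 B" if "norm v \<le> R" for v
    using that by (auto simp: abs_le_iff le_max_iff_disj)
  then show thesis
    using that[of "max 0 B"] by auto
qed

lemma integrable_vec_nth: "integrable M f \<Longrightarrow> integrable M (\<lambda>t. f t $ i :: real)"
  by (rule integrable_bounded_linear[OF bounded_linear_vec_nth])

section \<open>The integral operator as a positive contraction\<close>

locale positive_contraction =
  fixes a b :: real and K :: "real \<Rightarrow> real \<Rightarrow> real"
  assumes less: "a < b"
    and continuous_kernel: "continuous_on ({a..b} \<times> {a..b}) (\<lambda>(x, t). K x t)"
    and positive: "positive_op a b (int_op a b K)"
    and contraction: "L1_contraction a b (int_op a b K)"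
begin

abbreviation "M \<equiv> lebesgue_on {a..b}"
abbreviation "T \<equiv> int_op a b K"
abbreviation "nrm \<equiv> L1_norm abs a b"

lemma kernel_bounded: obtains B where "0 \<le> B" "\<And>x t. x \<in> {a..b} \<Longrightarrow> t \<in> {a..b} \<Longrightarrow> \<bar>K x t\<bar> \<le> B"
proof -
  have "compact ((\<lambda>(x, t). K x t) ` ({a..b} \<times> {a..b}))"
    by (intro compact_continuous_image continuous_kernel compact_Times) auto
  then obtain B where "\<forall>z\<in>(\<lambda>(x, t). K x t) ` ({a..b} \<times> {a..b}). norm z \<le> B"
    using compact_imp_bounded bounded_iff by metis
  then have "\<bar>K x t\<bar> \<le> max 0 B" if "x \<in> {a..b}" "t \<in> {a..b}" for x t
    using that by (auto simp: le_max_iff_disj)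
  then show thesis
    using that[of "max 0 B"] by auto
qed

lemma kernel_measurable:
  assumes "x \<in> {a..b}"
  shows "K x \<in> borel_measurable M"
proof -
  have "continuous_on {a..b} (\<lambda>t. (\<lambda>(x, t). K x t) (x, t))"
    by (rule continuous_on_compose2[OF continuous_kernel]) (use assms in \<open>auto intro!: continuous_intros\<close>)
  then show ?thesis
    by (intro continuous_imp_measurable_on_sets_lebesgue) auto
qed

lemma integrable_kernel:
  assumes "x \<in> {a..b}" "integrable M f"
  shows "integrable M (\<lambda>t. K x t * f t)"
proof -
  obtain B where B: "0 \<le> B" "\<And>x t. x \<in> {a..b} \<Longrightarrow> t \<in> {a..b} \<Longrightarrow> \<bar>K x t\<bar> \<le> B"
    using kernel_bounded by blast
  show ?thesis
  proof (rule Bochner_Integration.integrable_bound)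
    show "integrable M (\<lambda>t. B * \<bar>f t\<bar>)"
      using assms by auto
    show "(\<lambda>t. K x t * f t) \<in> borel_measurable M"
      using assms kernel_measurable by auto
    show "AE t in M. norm (K x t * f t) \<le> norm (B * \<bar>f t\<bar>)"
      by (rule AE_I2) (use B assms in \<open>auto simp: abs_mult intro!: mult_right_mono\<close>)
  qed
qed

lemma T_add:
  "x \<in> {a..b} \<Longrightarrow> integrable M f \<Longrightarrow> integrable M g \<Longrightarrow> T (\<lambda>t. f t + g t) x = T f x + T g x"
  by (simp add: int_op_eq distrib_left integrable_kernel)

lemma T_diff:
  "x \<in> {a..b} \<Longrightarrow> integrable M f \<Longrightarrow> integrable M g \<Longrightarrow> T (\<lambda>t. f t - g t) x = T f x - T g x"
  by (simp add: int_op_eq right_diff_distrib integrable_kernel)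

lemma T_scale: "T (\<lambda>t. c * f t) x = c * T f x"
  by (simp add: int_op_eq mult.left_commute)

lemma T_sum:
  assumes "x \<in> {a..b}" "\<And>i. i \<in> I \<Longrightarrow> integrable M (f i)"
  shows "T (\<lambda>t. \<Sum>i\<in>I. f i t) x = (\<Sum>i\<in>I. T (f i) x)"
  unfolding int_op_eq sum_distrib_left
  by (rule Bochner_Integration.integral_sum) (use assms integrable_kernel in auto)

text \<open>Continuity of the kernel passes to \<open>T f\<close> by dominated convergence. This is
  the source of measurability and integrability of \<open>T f\<close>.\<close>

lemma T_continuous:
  assumes "integrable M f"
  shows "continuous_on {a..b} (T f)"
  unfolding continuous_on_sequentially comp_def
proof (intro allI ballI impI)
  fix u x assume x: "x \<in> {a..b}" and u: "(\<forall>n. u n \<in> {a..b}) \<and> u \<longlonglongrightarrow> x"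
  obtain B where B: "0 \<le> B" "\<And>x t. x \<in> {a..b} \<Longrightarrow> t \<in> {a..b} \<Longrightarrow> \<bar>K x t\<bar> \<le> B"
    using kernel_bounded by blast
  have K_lim: "(\<lambda>n. K (u n) t) \<longlonglongrightarrow> K x t" if "t \<in> {a..b}" for t
    using continuous_on_tendsto_compose[OF continuous_kernel, of "\<lambda>n. (u n, t)" "(x, t)" sequentially]
      u x that tendsto_Pair[of u x sequentially "\<lambda>_. t" t] by simp
  show "(\<lambda>n. T f (u n)) \<longlonglongrightarrow> T f x"
    unfolding int_op_eq
  proof (rule integral_dominated_convergence)
    show "integrable M (\<lambda>t. B * \<bar>f t\<bar>)"
      using assms by auto
    show "(\<lambda>t. K x t * f t) \<in> borel_measurable M"
      using assms kernel_measurable x by auto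
    show "(\<lambda>t. K (u n) t * f t) \<in> borel_measurable M" for n
      using assms kernel_measurable u by auto
    show "AE t in M. (\<lambda>n. K (u n) t * f t) \<longlonglongrightarrow> K x t * f t"
      by (rule AE_I2) (use K_lim in \<open>auto intro!: tendsto_intros\<close>)
    show "AE t in M. norm (K (u n) t * f t) \<le> B * \<bar>f t\<bar>" for n
      by (rule AE_I2) (use B u in \<open>auto simp: abs_mult intro!: mult_right_mono\<close>)
  qed
qed

lemma T_integrable: "integrable M f \<Longrightarrow> integrable M (T f)"
  using absolutely_integrable_continuous_real[OF T_continuous] absolutely_integrable_eq by blast

lemma T_mono:
  assumes "integrable M f" "integrable M g" "\<And>t. t \<in> {a..b} \<Longrightarrow> f t \<le> g t" "x \<in> {a..b}"
  shows "T f x \<le> T g x"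
proof -
  have "0 \<le> T (\<lambda>t. g t - f t) x"
    using positive assms by (auto simp: positive_op_def absolutely_integrable_eq)
  then show ?thesis
    using assms by (simp add: T_diff)
qed

lemma T_contraction: "integrable M f \<Longrightarrow> nrm (T f) \<le> nrm f"
  using contraction by (simp add: L1_contraction_def absolutely_integrable_eq)

section \<open>The approximation error of scalar test functions\<close>

definition err :: "(real \<Rightarrow> real) \<Rightarrow> real" where
  "err f = nrm (\<lambda>x. T f x - f x)"

lemma err_nonneg: "0 \<le> err f"
  by (simp add: err_def L1_norm_abs_nonneg)

lemma err_scale: "err (\<lambda>t. c * f t) = \<bar>c\<bar> * err f"
  by (simp add: err_def L1_norm_eq T_scale flip: right_diff_distrib) (simp add: abs_mult)

lemma err_diff:
  assumes "integrable M f" "integrable M g"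
  shows "err (\<lambda>t. f t - g t) \<le> err f + err g"
proof -
  have "err (\<lambda>t. f t - g t) \<le> integral\<^sup>L M (\<lambda>x. \<bar>T f x - f x\<bar> + \<bar>T g x - g x\<bar>)"
    unfolding err_def
    by (rule L1_norm_mono) (use assms T_integrable in \<open>auto simp: T_diff cong: integrable_cong\<close>)
  also have "\<dots> = err f + err g"
    using assms T_integrable by (simp add: err_def L1_norm_eq)
  finally show ?thesis .
qed

text \<open>The triangle inequality and contraction. It disposes of remainders that are small in L1
  and gives a crude bound on \<open>l\<close>.\<close>

lemma err_le_2_nrm:
  assumes "integrable M f"
  shows "err f \<le> 2 * nrm f"
proof -
  have "err f \<le> integral\<^sup>L M (\<lambda>x. \<bar>T f x\<bar> + \<bar>f x\<bar>)"
    unfolding err_def by (rule L1_norm_mono) (use assms T_integrable in auto)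
  also have "\<dots> = nrm (T f) + nrm f"
    using assms T_integrable by (simp add: L1_norm_eq)
  finally show ?thesis
    using T_contraction[OF assms] by simp
qed

lemma integrable_diff_const: "integrable M (\<lambda>t. t - u)"
  by (rule integrable_bounded_interval[where B="\<bar>a\<bar> + \<bar>b\<bar> + \<bar>u\<bar>"])
     (auto intro: borel_measurable_interval)

lemma integrable_const_interval: "integrable M (\<lambda>t. c::real)"
  by (rule integrable_bounded_interval[where B="\<bar>c\<bar>"]) auto

lemma integrable_trunc: "integrable M (\<lambda>t. max 0 (t - u))"
  by (rule integrable_bounded_interval[where B="\<bar>a\<bar> + \<bar>b\<bar> + \<bar>u\<bar>"])
     (auto intro!: borel_measurable_interval)

lemma integrable_step: "integrable M (indicator {u..} :: real \<Rightarrow> real)"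
  by (rule integrable_bounded_interval[where B=1])
     (auto intro!: borel_measurable_interval simp: indicator_def)

abbreviation "l \<equiv> lam a b T"

lemma lam_eq: "l = sqrt (max (err (\<lambda>t. 1)) (err (\<lambda>t. t)))"
  by (simp add: lam_def err_def max.commute)

lemma lam_nonneg: "0 \<le> l"
  by (simp add: lam_eq err_nonneg le_max_iff_disj)

lemma lam_sq: "l\<^sup>2 = max (err (\<lambda>t. 1)) (err (\<lambda>t. t))"
  by (simp add: lam_eq err_nonneg le_max_iff_disj)

lemma err_affine: "err (\<lambda>t. t - u) \<le> (1 + \<bar>u\<bar>) * l\<^sup>2"
proof -
  have "err (\<lambda>t. t - u * 1) \<le> err (\<lambda>t. t) + err (\<lambda>t. u * 1)"
    by (rule err_diff) (use integrable_diff_const[of 0] integrable_const_interval in auto)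
  moreover have "err (\<lambda>t. u * 1) = \<bar>u\<bar> * err (\<lambda>t. 1)"
    by (rule err_scale)
  moreover have "\<bar>u\<bar> * err (\<lambda>t. 1) \<le> \<bar>u\<bar> * l\<^sup>2" "err (\<lambda>t. t) \<le> l\<^sup>2"
    by (auto simp: lam_sq intro: mult_left_mono)
  ultimately show ?thesis
    by (simp add: distrib_right)
qed

text \<open>Positivity bounds \<open>T \<phi> - \<phi>\<close> from below, since \<open>\<phi>\<close> is the maximum of two affine functions.
  By contraction its integral is nonpositive, hence the lower bound controls the positive part too.\<close>

lemma err_trunc: "err (\<lambda>t. max 0 (t - u)) \<le> 2 * (1 + \<bar>u\<bar>) * l\<^sup>2"
proof -
  let ?f = "\<lambda>t. max 0 (t - u)"
  have Tf: "integrable M (T ?f)" and Tp: "integrable M (T (\<lambda>t. t - u))"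
    by (intro T_integrable integrable_trunc integrable_diff_const)+
  have f_nonneg: "0 \<le> T ?f x" if "x \<in> {a..b}" for x
    using positive integrable_trunc that by (auto simp: positive_op_def absolutely_integrable_eq)
  have "\<bar>T ?f x - ?f x\<bar> \<le> (T ?f x - ?f x) + 2 * \<bar>T (\<lambda>t. t - u) x - (x - u)\<bar>" if "x \<in> {a..b}" for x
  proof -
    \<comment> \<open>For z = A - max 0 y, |z| is z plus twice its negative part. That part is at
      most |P - y|: it is 0 for y <= 0, as A >= 0, and y - A <= y - P for y >= 0.\<close>
    have "\<bar>A - max 0 y\<bar> \<le> (A - max 0 y) + 2 * \<bar>P - y\<bar>" if "0 \<le> A" "P \<le> A" for A P y :: real
      using that by (auto simp: abs_if max_def)
    then show ?thesis
      using f_nonneg[OF that] T_mono[OF integrable_diff_const integrable_trunc _ that, of u u] by simp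
  qed
  then have "err ?f \<le> integral\<^sup>L M (\<lambda>x. (T ?f x - ?f x) + 2 * \<bar>T (\<lambda>t. t - u) x - (x - u)\<bar>)"
    unfolding err_def
    by (intro L1_norm_mono) (use Tf Tp integrable_trunc integrable_diff_const in auto)
  also have "\<dots> = (integral\<^sup>L M (T ?f) - integral\<^sup>L M ?f) + 2 * err (\<lambda>t. t - u)"
    using Tf Tp integrable_trunc[of u] integrable_diff_const[of u] by (simp add: err_def L1_norm_eq)
  also have "integral\<^sup>L M (T ?f) = nrm (T ?f)"
    unfolding L1_norm_eq by (rule Bochner_Integration.integral_cong) (use f_nonneg in auto)
  also have "integral\<^sup>L M ?f = nrm ?f"
    unfolding L1_norm_eq by simp
  finally show ?thesis
    using T_contraction[OF integrable_trunc, of u] err_affine[of u] by (simp add: algebra_simps)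
qed

text \<open>The ramp \<open>?g\<close> is a scaled difference of truncated powers, so its error is
  of order \<open>l\<^sup>2 / \<delta>\<close>. The remainder \<open>?h - ?g\<close> is at most 1 in
  size and vanishes outside an interval of length \<open>\<delta>\<close>, so contraction bounds its
  error by \<open>2 * \<delta>\<close>. With \<open>\<delta>\<close> free, both
  \<open>\<delta> = l\<close> and \<delta> tending to 0 are available.\<close>

lemma err_step_delta:
  assumes "0 < \<delta>"
  shows "err (indicator {u..}) \<le> 2 * \<delta> + 4 * (1 + \<bar>u\<bar> + \<delta>) * l\<^sup>2 / \<delta>"
proof -
  let ?h = "indicator {u..} :: real \<Rightarrow> real"
  let ?\<phi> = "\<lambda>u t. max 0 (t - u) :: real"
  let ?d = "\<lambda>t. ?\<phi> u t - ?\<phi> (u + \<delta>) t"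
  let ?g = "\<lambda>t. (1 / \<delta>) * ?d t"
  have d: "integrable M ?d"
    using integrable_trunc by simp
  then have g: "integrable M ?g"
    by simp
  have gh: "integrable M (\<lambda>t. ?h t - ?g t)"
    using g integrable_step by simp
  have "err ?d \<le> 2 * (1 + \<bar>u\<bar>) * l\<^sup>2 + 2 * (1 + \<bar>u + \<delta>\<bar>) * l\<^sup>2"
    using err_diff[OF integrable_trunc integrable_trunc, of u "u + \<delta>"]
      err_trunc[of u] err_trunc[of "u + \<delta>"] by linarith
  also have "\<dots> = (2 * (1 + \<bar>u\<bar>) + 2 * (1 + \<bar>u + \<delta>\<bar>)) * l\<^sup>2"
    by (simp add: distrib_right)
  also have "\<dots> \<le> 4 * (1 + \<bar>u\<bar> + \<delta>) * l\<^sup>2"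
    using assms by (intro mult_right_mono) (auto intro: order_trans[OF mult_left_mono[OF abs_triangle_ineq]])
  finally have "err ?g \<le> 4 * (1 + \<bar>u\<bar> + \<delta>) * l\<^sup>2 / \<delta>"
    unfolding err_scale using assms by (simp add: divide_right_mono)
  moreover have "nrm (\<lambda>t. ?h t - ?g t) \<le> \<delta>"
  proof -
    have ind: "integrable M (indicator {u..u + \<delta>} :: real \<Rightarrow> real)"
      by (rule integrable_bounded_interval[where B=1])
         (auto intro!: borel_measurable_interval simp: indicator_def)
    have "nrm (\<lambda>t. ?h t - ?g t) \<le> integral\<^sup>L M (indicator {u..u + \<delta>})"
    proof (rule L1_norm_mono)
      fix t
      show "\<bar>?h t - ?g t\<bar> \<le> indicator {u..u + \<delta>} t"
        using assms by (auto simp: indicator_def max_def field_simps abs_if)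
    qed (use gh ind in auto)
    also have "\<dots> = measure lebesgue ({u..u + \<delta>} \<inter> {a..b})"
      by (simp add: measure_restrict_space)
    also have "\<dots> \<le> measure lebesgue {u..u + \<delta>}"
      by (rule measure_mono_fmeasurable) auto
    finally show ?thesis
      using assms by simp
  qed
  moreover have "err ?h \<le> err (\<lambda>t. ?h t - ?g t) + err ?g"
  proof -
    \<comment> \<open>Subadditivity of \<open>err\<close> for the sum of \<open>?h - ?g\<close> and
      \<open>?g\<close>, shown pointwise because \<open>err_diff\<close> is about
      differences.\<close>
    have "err ?h \<le> integral\<^sup>L M (\<lambda>x. \<bar>T (\<lambda>t. ?h t - ?g t) x - (?h x - ?g x)\<bar> + \<bar>T ?g x - ?g x\<bar>)"
      unfolding err_def
    proof (rule L1_norm_mono)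
      fix x assume "x \<in> {a..b}"
      then have "T (\<lambda>t. ?h t - ?g t) x = T ?h x - T ?g x"
        by (intro T_diff integrable_step g)
      then show "\<bar>T ?h x - ?h x\<bar> \<le> \<bar>T (\<lambda>t. ?h t - ?g t) x - (?h x - ?g x)\<bar> + \<bar>T ?g x - ?g x\<bar>"
        by linarith
    next
      show "integrable M (\<lambda>x. \<bar>T ?h x - ?h x\<bar>)"
        by (intro integrable_abs Bochner_Integration.integrable_diff T_integrable integrable_step)
      show "integrable M (\<lambda>x. \<bar>T (\<lambda>t. ?h t - ?g t) x - (?h x - ?g x)\<bar> + \<bar>T ?g x - ?g x\<bar>)"
        by (intro Bochner_Integration.integrable_add integrable_abs Bochner_Integration.integrable_diff
            T_integrable integrable_step g gh)
    qed
    also have "\<dots> = err (\<lambda>t. ?h t - ?g t) + err ?g"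
      unfolding err_def L1_norm_eq
      by (intro Bochner_Integration.integral_add integrable_abs Bochner_Integration.integrable_diff
            T_integrable integrable_step g gh)
    finally show ?thesis .
  qed
  moreover note err_le_2_nrm[OF gh]
  ultimately show ?thesis
    by linarith
qed

text \<open>Contraction alone bounds \<open>l\<close> in terms of \<open>a\<close> and
  \<open>b\<close>. This turns a surplus factor \<open>l\<close> into an admissible constant, in
  \<open>err_step\<close> and again in the final estimate.\<close>

lemma lam_le: "l \<le> sqrt (2 * (1 + \<bar>a\<bar> + \<bar>b\<bar>) * (b - a))"
proof -
  \<comment> \<open>The number 1 + |a| + |b| dominates both 1 and t on the interval.\<close>
  have "err f \<le> 2 * (1 + \<bar>a\<bar> + \<bar>b\<bar>) * (b - a)"
    if "integrable M f" "\<And>t. t \<in> {a..b} \<Longrightarrow> \<bar>f t\<bar> \<le> 1 + \<bar>a\<bar> + \<bar>b\<bar>" for f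
  proof -
    have "nrm f \<le> integral\<^sup>L M (\<lambda>_. 1 + \<bar>a\<bar> + \<bar>b\<bar>)"
      by (rule L1_norm_mono) (use that integrable_const_interval in auto)
    then show ?thesis
      using err_le_2_nrm[OF that(1)] less by (simp add: algebra_simps)
  qed
  note bound = this
  have "err (\<lambda>_. 1) \<le> 2 * (1 + \<bar>a\<bar> + \<bar>b\<bar>) * (b - a)"
    by (rule bound) (auto intro: integrable_const_interval)
  moreover have "err (\<lambda>t. t) \<le> 2 * (1 + \<bar>a\<bar> + \<bar>b\<bar>) * (b - a)"
    by (rule bound) (use integrable_diff_const[of 0] in auto)
  ultimately show ?thesis
    unfolding lam_eq by simp
qed

text \<open>The choice \<open>\<delta> = l\<close> balances the two terms, both becoming multiples
  of \<open>l\<close>; the \<open>l\<close> left inside the bracket is absorbed by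
  \<open>lam_le\<close>. Since \<open>\<delta>\<close> must be positive, \<open>l = 0\<close> is a
  separate case.\<close>

lemma err_step:
  assumes "u \<in> {a..b}"
  shows "err (indicator {u..}) \<le>
    (6 + 4 * (\<bar>a\<bar> + \<bar>b\<bar>) + 4 * sqrt (2 * (1 + \<bar>a\<bar> + \<bar>b\<bar>) * (b - a))) * l"
proof (cases "l = 0")
  case True
  \<comment> \<open>For \<open>l = 0\<close> only the term \<open>2 * \<delta>\<close> survives, so
    \<open>\<delta> = e / 2\<close> gives exactly \<open>e\<close>.\<close>
  have "err (indicator {u..}) \<le> 0 + e" if "0 < e" for e
    using err_step_delta[of "e / 2" u] that True by simp
  then have "err (indicator {u..}) \<le> 0"
    by (rule field_le_epsilon)
  with True show ?thesis
    by simp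
next
  case False
  then have l: "0 < l"
    using lam_nonneg by simp
  have "err (indicator {u..}) \<le> (2 + 4 * (1 + \<bar>u\<bar> + l)) * l"
  proof -
    have "4 * (1 + \<bar>u\<bar> + l) * l\<^sup>2 / l = 4 * (1 + \<bar>u\<bar> + l) * l"
      using l by (simp add: power2_eq_square)
    then show ?thesis
      using err_step_delta[OF l, of u] by (simp add: distrib_right)
  qed
  also have "\<dots> \<le> (6 + 4 * (\<bar>a\<bar> + \<bar>b\<bar>) + 4 * sqrt (2 * (1 + \<bar>a\<bar> + \<bar>b\<bar>) * (b - a))) * l"
    using l lam_le assms by (intro mult_right_mono) auto
  finally show ?thesis .
qed

section \<open>The vector-valued operator on step functions\<close>

abbreviation "Tv \<equiv> int_op_vec a b K"

lemma Tv_step_fun: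
  fixes z :: "real^'d"
  assumes "x \<in> {a..b}"
  shows "Tv (\<lambda>t. z + (\<Sum>i<n. indicator {u i..} t *\<^sub>R d i)) x =
    T (\<lambda>_. 1) x *\<^sub>R z + (\<Sum>i<n. T (indicator {u i..}) x *\<^sub>R d i)"
unfolding vec_eq_iff
proof
  fix j
  have int: "integrable M (\<lambda>t. d i $ j * indicator {u i..} t)" for i
    using integrable_step by simp
  \<comment> \<open>The factor 1 in \<open>z $ j * 1\<close> lets \<open>T_scale\<close> treat the
    constant like the other terms.\<close>
  have "T (\<lambda>t. z $ j * 1 + (\<Sum>i<n. d i $ j * indicator {u i..} t)) x =
      T (\<lambda>t. z $ j * 1) x + T (\<lambda>t. \<Sum>i<n. d i $ j * indicator {u i..} t) x"
    by (intro T_add assms Bochner_Integration.integrable_sum int integrable_const_interval)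
  also have "T (\<lambda>t. \<Sum>i<n. d i $ j * indicator {u i..} t) x =
      (\<Sum>i<n. T (\<lambda>t. d i $ j * indicator {u i..} t) x)"
    by (intro T_sum assms int)
  finally have "T (\<lambda>t. z $ j * 1 + (\<Sum>i<n. d i $ j * indicator {u i..} t)) x =
      z $ j * T (\<lambda>_. 1) x + (\<Sum>i<n. d i $ j * T (indicator {u i..}) x)"
    by (simp only: T_scale)
  then show "Tv (\<lambda>t. z + (\<Sum>i<n. indicator {u i..} t *\<^sub>R d i)) x $ j =
      (T (\<lambda>_. 1) x *\<^sub>R z + (\<Sum>i<n. T (indicator {u i..}) x *\<^sub>R d i)) $ j"
    by (simp add: int_op_vec_def sum_component mult.commute)
qed

lemma Tv_continuous:
  fixes f :: "real \<Rightarrow> real^'d"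
  assumes "integrable M f"
  shows "continuous_on {a..b} (Tv f)"
  unfolding int_op_vec_def
  by (intro continuous_on_vec_lambda T_continuous integrable_vec_nth assms)

text \<open>The difference is a combination of scalar errors with the vectors \<open>z\<close> and
  \<open>d i\<close> as coefficients, so the triangle inequality leaves only \<open>N\<close> of
  these vectors. As the jumps are not split into components, no factor depending on the dimension
  appears.\<close>

lemma L1_norm_step_fun:
  fixes z :: "real^'d" and u :: "nat \<Rightarrow> real" and d :: "nat \<Rightarrow> real^'d" and n :: nat
  assumes "is_norm N"
  defines "c \<equiv> \<lambda>t. z + (\<Sum>i<n. indicator {u i..} t *\<^sub>R d i)"
  assumes int: "integrable M (\<lambda>t. N (c t - Tv c t))"
  shows "L1_norm N a b (\<lambda>t. c t - Tv c t) \<le> N z * err (\<lambda>_. 1) + (\<Sum>i<n. N (d i) * err (indicator {u i..}))"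
proof -
  let ?g = "\<lambda>t. N z * \<bar>T (\<lambda>_. 1) t - 1\<bar> +
    (\<Sum>i<n. N (d i) * \<bar>T (indicator {u i..}) t - indicator {u i..} t\<bar>)"
  have ints: "integrable M (\<lambda>t. \<bar>T (\<lambda>_. 1) t - 1\<bar>)"
    "\<And>i. integrable M (\<lambda>t. \<bar>T (indicator {u i..}) t - indicator {u i..} t\<bar>)"
    by (intro integrable_abs Bochner_Integration.integrable_diff T_integrable integrable_step
        integrable_const_interval)+
  have "L1_norm N a b (\<lambda>t. c t - Tv c t) \<le> integral\<^sup>L M ?g"
  proof (rule L1_norm_mono)
    show "integrable M (\<lambda>t. N (c t - Tv c t))"
      by (rule int)
    show "integrable M ?g"
      using ints by simp
    fix t assume t: "t \<in> {a..b}"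
    let ?\<alpha> = "T (\<lambda>_. 1) t - 1" and ?\<beta> = "\<lambda>i. T (indicator {u i..}) t - indicator {u i..} t"
    have c: "c t - Tv c t = - (?\<alpha> *\<^sub>R z + (\<Sum>i<n. ?\<beta> i *\<^sub>R d i))"
      unfolding c_def Tv_step_fun[OF t] by (simp add: scaleR_diff_left sum_subtractf)
    have "N (\<Sum>i<n. ?\<beta> i *\<^sub>R d i) \<le> (\<Sum>i<n. N (?\<beta> i *\<^sub>R d i))"
      by (rule is_norm_sum[OF assms(1)])
    then have "N (c t - Tv c t) \<le> N (?\<alpha> *\<^sub>R z) + (\<Sum>i<n. N (?\<beta> i *\<^sub>R d i))"
      unfolding c is_norm_minus[OF assms(1)]
      using is_normD(3)[OF assms(1), of "?\<alpha> *\<^sub>R z" "\<Sum>i<n. ?\<beta> i *\<^sub>R d i"] by linarith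
    then show "N (c t - Tv c t) \<le> ?g t"
      by (simp add: is_normD(2)[OF assms(1)] mult.commute)
  qed
  also have "\<dots> = N z * err (\<lambda>_. 1) + (\<Sum>i<n. N (d i) * err (indicator {u i..}))"
    using ints by (simp add: err_def L1_norm_eq)
  finally show ?thesis .
qed

section \<open>Dominated convergence for f - T f\<close>

context
  fixes N :: "real^'d \<Rightarrow> real"
  assumes N: "is_norm N"
begin

text \<open>The point is uniformity: \<open>R'\<close> is chosen before \<open>f\<close>, so that
  one majorant serves a whole sequence of chain functions.\<close>

lemma Tv_bounded:
  obtains R' where
    "\<And>f x. integrable M f \<Longrightarrow> (\<And>t. t \<in> {a..b} \<Longrightarrow> norm (f t) \<le> R) \<Longrightarrow> x \<in> {a..b} \<Longrightarrow>
      norm (Tv f x :: real^'d) \<le> R'"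
proof -
  obtain B where B: "0 \<le> B" "\<And>x t. x \<in> {a..b} \<Longrightarrow> t \<in> {a..b} \<Longrightarrow> \<bar>K x t\<bar> \<le> B"
    using kernel_bounded by blast
  have "norm (Tv f x :: real^'d) \<le> CARD('d) * (B * R * (b - a))"
    if f: "integrable M f" "\<And>t. t \<in> {a..b} \<Longrightarrow> norm (f t) \<le> R" and x: "x \<in> {a..b}" for f x
  proof -
    have "\<bar>Tv f x $ i\<bar> \<le> B * R * (b - a)" for i :: 'd
    proof -
      have int: "integrable M (\<lambda>t. K x t * f t $ i)"
        by (intro integrable_kernel integrable_vec_nth f x)
      have "\<bar>Tv f x $ i\<bar> \<le> integral\<^sup>L M (\<lambda>t. \<bar>K x t * f t $ i\<bar>)"
        by (simp add: int_op_vec_def int_op_eq)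
      also have "\<dots> \<le> integral\<^sup>L M (\<lambda>_. B * R)"
      proof (rule integral_mono)
        fix t assume "t \<in> space M"
        then have t: "t \<in> {a..b}" by simp
        show "\<bar>K x t * f t $ i\<bar> \<le> B * R"
          unfolding abs_mult
          using B t x order_trans[OF component_le_norm_cart f(2)[OF t]] by (intro mult_mono) auto
      qed (use int integrable_const_interval in auto)
      finally show ?thesis
        using less by (simp add: mult_ac)
    qed
    then have "(\<Sum>i\<in>UNIV. \<bar>Tv f x $ i\<bar>) \<le> (\<Sum>i\<in>(UNIV::'d set). B * R * (b - a))"
      by (intro sum_mono) auto
    with norm_le_l1_cart[of "Tv f x"] show ?thesis
      by simp
  qed
  then show thesis
    by (rule that)
qed

lemma measurable_N_diff_Tv:
  assumes "integrable M f"
  shows "(\<lambda>t. N (f t - Tv f t)) \<in> borel_measurable M"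
proof -
  have "Tv f \<in> borel_measurable M"
    by (intro continuous_imp_measurable_on_sets_lebesgue Tv_continuous assms) auto
  moreover have "N \<in> borel_measurable borel"
    by (rule borel_measurable_continuous_onI[OF is_norm_continuous[OF N]])
  ultimately show ?thesis
    using assms by (intro measurable_compose[where f="\<lambda>t. f t - Tv f t" and g=N]) auto
qed

lemma N_diff_Tv_bounded:
  obtains B where
    "\<And>f x. integrable M f \<Longrightarrow> (\<And>t. t \<in> {a..b} \<Longrightarrow> norm (f t) \<le> R) \<Longrightarrow> x \<in> {a..b} \<Longrightarrow>
      N (f x - Tv f x) \<le> B"
proof -
  obtain R' where R': "\<And>f x. integrable M f \<Longrightarrow> (\<And>t. t \<in> {a..b} \<Longrightarrow> norm (f t) \<le> R) \<Longrightarrow> x \<in> {a..b} \<Longrightarrow>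
      norm (Tv f x :: real^'d) \<le> R'"
    using Tv_bounded by blast
  obtain B where B: "0 \<le> B" "\<And>v. norm v \<le> R + R' \<Longrightarrow> N v \<le> B"
    using is_norm_bounded[OF N] by blast
  show thesis
  proof (rule that, rule B(2))
    fix f :: "real \<Rightarrow> real^'d" and x assume f: "integrable M f" "\<And>t. t \<in> {a..b} \<Longrightarrow> norm (f t) \<le> R" "x \<in> {a..b}"
    show "norm (f x - Tv f x) \<le> R + R'"
      using norm_triangle_ineq4[of "f x" "Tv f x"] R'[OF f] f(2)[OF f(3)] by linarith
  qed
qed

lemma integrable_N_diff_Tv:
  assumes "integrable M f" "\<And>t. t \<in> {a..b} \<Longrightarrow> norm (f t) \<le> R"
  shows "integrable M (\<lambda>t. N (f t - Tv f t))"
proof -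
  obtain B where "\<And>x. x \<in> {a..b} \<Longrightarrow> N (f x - Tv f x) \<le> B"
    using N_diff_Tv_bounded assms by metis
  then show ?thesis
    by (intro integrable_bounded_interval[where B=B] measurable_N_diff_Tv assms(1))
       (simp add: is_norm_nonneg[OF N])
qed

text \<open>Dominated convergence is applied twice: in t for fixed x, giving pointwise convergence
  of \<open>Tv (c k)\<close>, and then in the outer integral with the uniform bound of
  \<open>N_diff_Tv_bounded\<close>.\<close>

lemma L1_norm_diff_Tv_tendsto:
  fixes c :: "nat \<Rightarrow> real \<Rightarrow> real^'d"
  assumes int: "\<And>k. integrable M (c k)" "integrable M s"
    and bound: "\<And>k t. t \<in> {a..b} \<Longrightarrow> norm (c k t) \<le> R"
    and lim: "\<And>t. t \<in> {a..b} \<Longrightarrow> (\<lambda>k. c k t) \<longlonglongrightarrow> s t"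
  shows "(\<lambda>k. L1_norm N a b (\<lambda>t. c k t - Tv (c k) t)) \<longlonglongrightarrow> L1_norm N a b (\<lambda>t. s t - Tv s t)"
proof -
  obtain BK where BK: "0 \<le> BK" "\<And>x t. x \<in> {a..b} \<Longrightarrow> t \<in> {a..b} \<Longrightarrow> \<bar>K x t\<bar> \<le> BK"
    using kernel_bounded by blast
  have T_lim: "(\<lambda>k. Tv (c k) x) \<longlonglongrightarrow> Tv s x" if x: "x \<in> {a..b}" for x
  proof (rule vec_tendstoI)
    fix i
    have "(\<lambda>k. integral\<^sup>L M (\<lambda>t. K x t * c k t $ i)) \<longlonglongrightarrow> integral\<^sup>L M (\<lambda>t. K x t * s t $ i)"
    proof (rule integral_dominated_convergence)
      show "integrable M (\<lambda>t. BK * R)"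
        by (rule integrable_const_interval)
      show "(\<lambda>t. K x t * s t $ i) \<in> borel_measurable M"
        "\<And>k. (\<lambda>t. K x t * c k t $ i) \<in> borel_measurable M"
        by (intro borel_measurable_integrable integrable_kernel integrable_vec_nth int x)+
      show "AE t in M. (\<lambda>k. K x t * c k t $ i) \<longlonglongrightarrow> K x t * s t $ i"
        by (rule AE_I2) (auto intro!: tendsto_intros lim)
      show "AE t in M. norm (K x t * c k t $ i) \<le> BK * R" for k
      proof (rule AE_I2)
        fix t assume "t \<in> space M"
        then have t: "t \<in> {a..b}" by simp
        show "norm (K x t * c k t $ i) \<le> BK * R"
          unfolding real_norm_def abs_mult
          using BK t x order_trans[OF component_le_norm_cart bound[OF t]] by (intro mult_mono) auto
      qed
    qed
    then show "(\<lambda>k. Tv (c k) x $ i) \<longlonglongrightarrow> Tv s x $ i"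
      by (simp add: int_op_vec_def int_op_eq)
  qed
  obtain B where B: "\<And>f x. integrable M f \<Longrightarrow> (\<And>t. t \<in> {a..b} \<Longrightarrow> norm (f t) \<le> R) \<Longrightarrow> x \<in> {a..b} \<Longrightarrow>
      N (f x - Tv f x) \<le> B"
    using N_diff_Tv_bounded by blast
  show ?thesis
    unfolding L1_norm_eq
  proof (rule integral_dominated_convergence)
    show "integrable M (\<lambda>t. B)"
      by (rule integrable_const_interval)
    show "AE t in M. (\<lambda>k. N (c k t - Tv (c k) t)) \<longlonglongrightarrow> N (s t - Tv s t)"
    proof (rule AE_I2)
      fix t assume "t \<in> space M"
      then have t: "t \<in> {a..b}" by simp
      then have "(\<lambda>k. c k t - Tv (c k) t) \<longlonglongrightarrow> s t - Tv s t"
        by (intro tendsto_intros lim T_lim)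
      then show "(\<lambda>k. N (c k t - Tv (c k) t)) \<longlonglongrightarrow> N (s t - Tv s t)"
        by (rule continuous_on_tendsto_compose[OF is_norm_continuous[OF N]]) auto
    qed
    show "AE t in M. norm (N (c k t - Tv (c k) t)) \<le> B" for k
      by (rule AE_I2) (use B[of "c k"] int bound in \<open>simp add: is_norm_nonneg[OF N]\<close>)
  qed (intro measurable_N_diff_Tv int)+
qed

end

end

section \<open>Chain functions, their jumps and the variation\<close>

lemma is_partition_mono:
  assumes "is_partition a b n x" "i \<le> j" "j \<le> n"
  shows "x i \<le> x j"
  using assms(2,3)
proof (induction j rule: dec_induct)
  case (step k)
  with assms(1) have "x k < x (Suc k)"
    by (simp add: is_partition_def)
  with step show ?case
    by simp
qed simp

lemma is_partition_in:
  assumes "is_partition a b n x" "i \<le> n"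
  shows "x i \<in> {a..b}"
  using is_partition_mono[OF assms(1), of 0 i] is_partition_mono[OF assms(1), of i n] assms
  by (auto simp: is_partition_def)

text \<open>The index is described by the right endpoints not exceeding \<open>t\<close>, because
  these are what a sum of half-line indicators detects. The endpoint \<open>t = b\<close> fits in
  with \<open>i = n\<close>.\<close>

lemma chain_fun_cases:
  assumes p: "is_partition a b n x" and t: "t \<in> {a..b}"
  obtains i where "i \<le> n" "chain_fun n x y t = y i" "\<And>j. j < n \<Longrightarrow> x (Suc j) \<le> t \<longleftrightarrow> j < i"
proof (cases "t = b")
  case True
  show thesis
  proof (rule that[of n])
    show "chain_fun n x y t = y n"
      using p True by (simp add: chain_fun_def is_partition_def)
    show "x (Suc j) \<le> t \<longleftrightarrow> j < n" if "j < n" for j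
      using is_partition_in[OF p, of "Suc j"] that True by auto
  qed simp
next
  case False
  \<comment> \<open>The last node not exceeding \<open>t\<close>; it is not the final one, since
    \<open>t\<close> differs from \<open>b\<close> here.\<close>
  define i where "i = Max {i. i \<le> n \<and> x i \<le> t}"
  have fin: "finite {i. i \<le> n \<and> x i \<le> t}" and ne: "0 \<in> {i. i \<le> n \<and> x i \<le> t}"
    using p t by (auto simp: is_partition_def)
  have "i \<in> {i. i \<le> n \<and> x i \<le> t}"
    unfolding i_def using ne by (intro Max_in[OF fin]) blast
  then have i: "i \<le> n" "x i \<le> t"
    by auto
  have "i \<noteq> n"
    using i p t False by (auto simp: is_partition_def)
  with i have "i < n" by simp
  have ti: "t < x (Suc i)"
  proof (rule ccontr)
    assume "\<not> t < x (Suc i)"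
    then have "Suc i \<le> i"
      unfolding i_def using \<open>i < n\<close> by (intro Max_ge[OF fin]) (auto simp flip: i_def)
    then show False by simp
  qed
  have iff: "x (Suc j) \<le> t \<longleftrightarrow> j < i" if "j < n" for j
    using is_partition_mono[OF p, of "Suc j" i] is_partition_mono[OF p, of "Suc i" "Suc j"] i ti that
    by (cases "j < i") auto
  have "(THE i. i < n \<and> x i \<le> t \<and> t < x (Suc i)) = i"
  proof (rule the_equality)
    fix j assume j: "j < n \<and> x j \<le> t \<and> t < x (Suc j)"
    then have "\<not> j < i"
      using iff[of j] by auto
    moreover have "\<not> i < j"
      using is_partition_mono[OF p, of "Suc i" j] j ti by auto
    ultimately show "j = i" by simp
  qed (use \<open>i < n\<close> i ti in auto)
  moreover have "t \<noteq> x n"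
    using p False by (simp add: is_partition_def)
  ultimately have "chain_fun n x y t = y i"
    by (simp add: chain_fun_def)
  with i iff show thesis
    using that by blast
qed

text \<open>At \<open>t\<close> exactly the jumps before the current index are switched on, and they
  telescope. The half-lines are closed because a chain function takes its new value at the node
  itself.\<close>

lemma chain_fun_eq_step_fun:
  fixes y :: "nat \<Rightarrow> 'v::real_vector"
  assumes "is_partition a b n x" "t \<in> {a..b}"
  shows "chain_fun n x y t = y 0 + (\<Sum>i<n. indicator {x (Suc i)..} t *\<^sub>R (y (Suc i) - y i))"
proof -
  obtain i where i: "i \<le> n" "chain_fun n x y t = y i" "\<And>j. j < n \<Longrightarrow> x (Suc j) \<le> t \<longleftrightarrow> j < i"
    using chain_fun_cases[OF assms] by metis
  have "(\<Sum>j<n. indicator {x (Suc j)..} t *\<^sub>R (y (Suc j) - y j)) =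
      (\<Sum>j<n. if j < i then y (Suc j) - y j else 0)"
    by (rule sum.cong) (use i(3) in \<open>auto simp: indicator_def\<close>)
  also have "\<dots> = (\<Sum>j<i. y (Suc j) - y j)"
    using i(1) by (intro sum.mono_neutral_cong_right) auto
  also have "\<dots> = y i - y 0"
    by (rule sum_lessThan_telescope)
  finally show ?thesis
    using i(2) by simp
qed

text \<open>A projection attains the distance to the set, so the distance between \<open>p\<close>
  and \<open>q\<close> is one of the infima over which a supremum of the Hausdorff distance
  ranges.\<close>

lemma metric_pairs_le_haus:
  assumes N: "is_norm N" and pq: "(p, q) \<in> metric_pairs N A B"
  shows "ennreal (N (q - p)) \<le> haus N B A"
proof -
  have bdd: "bdd_below ((\<lambda>z. N (w - z)) ` C)" for w C
    by (rule bdd_belowI[of _ 0]) (auto simp: is_norm_nonneg[OF N])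
  have proj: "ennreal (N (w - z)) \<le> (INF z'\<in>C. ennreal (N (w - z')))" if "z \<in> metric_proj N C w" for w z C
    using that by (intro INF_greatest ennreal_leI) (auto simp: metric_proj_def intro: cINF_lower[OF bdd])
  from pq have A: "p \<in> A" and B: "q \<in> B"
    by (auto simp: metric_pairs_def)
  from pq consider "p \<in> metric_proj N A q" | "q \<in> metric_proj N B p"
    by (auto simp: metric_pairs_def)
  then show ?thesis
  proof cases
    case 1
    then have "ennreal (N (q - p)) \<le> (SUP w\<in>B. INF z\<in>A. ennreal (N (w - z)))"
      using proj B by (intro SUP_upper2[of q]) auto
    then show ?thesis
      by (simp add: haus_def hausdorff_def le_max_iff_disj)
  next
    case 2
    then have "ennreal (N (p - q)) \<le> (SUP z\<in>A. INF w\<in>B. ennreal (N (z - w)))"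
      using proj A by (intro SUP_upper2[of p]) auto
    then show ?thesis
      by (simp add: haus_def hausdorff_def le_max_iff_disj is_norm_minus_commute[OF N])
  qed
qed

text \<open>Here the chain condition pays off: each jump is at most the Hausdorff distance of
  consecutive values of \<open>F\<close>. The sum is reindexed because the variation counts from
  1.\<close>

lemma chain_sum_le_variation:
  assumes N: "is_norm N" and p: "is_partition a b n x"
    and y: "y \<in> metric_chains N n (\<lambda>i. F (x i))"
  shows "ennreal (\<Sum>i<n. N (y (Suc i) - y i)) \<le> variation N a b F"
proof -
  have "ennreal (\<Sum>i<n. N (y (Suc i) - y i)) = (\<Sum>i<n. ennreal (N (y (Suc i) - y i)))"
    by (simp add: is_norm_nonneg[OF N] flip: sum_ennreal)
  also have "\<dots> \<le> (\<Sum>i<n. haus N (F (x (Suc i))) (F (x i)))"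
    using y by (intro sum_mono metric_pairs_le_haus[OF N]) (auto simp: metric_chains_def)
  also have "\<dots> = (\<Sum>i=1..n. haus N (F (x i)) (F (x (i - 1))))"
    by (rule sum.reindex_bij_witness[of _ "\<lambda>i. i - 1" Suc]) auto
  also have "\<dots> \<le> variation N a b F"
    unfolding variation_def using p by (intro SUP_upper2[of "(n, x)"]) auto
  finally show ?thesis .
qed

text \<open>For \<open>n = 0\<close> the chain condition is vacuous, hence \<open>0 < n\<close>. The
  last entry occurs only as a second component of a pair, hence the case split.\<close>

lemma metric_chain_mem:
  assumes "y \<in> metric_chains N n A" "0 < n" "i \<le> n"
  shows "y i \<in> A i"
proof (cases "i = n")
  case True
  then obtain m where "n = Suc m" "i = Suc m"
    using assms(2) by (cases n) auto
  with assms show ?thesis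
    by (auto simp: metric_chains_def metric_pairs_def)
next
  case False
  with assms show ?thesis
    by (auto simp: metric_chains_def metric_pairs_def)
qed

lemma norm_le_set_norm:
  assumes "is_norm N" "v \<in> A"
  shows "ennreal (N v) \<le> set_norm N A"
  using assms(2) by (auto simp: set_norm_def haus_def hausdorff_def le_max_iff_disj intro: SUP_upper2[of v])

text \<open>Pairing each \<open>s\<close> with \<open>f s\<close>, in both directions, bounds both
  suprema at once. This reduces the theorem to one selection at a time.\<close>

lemma hausdorff_image_le:
  assumes "\<And>s. s \<in> S \<Longrightarrow> ennreal (d s (f s)) \<le> D"
  shows "hausdorff d S (f ` S) \<le> D"
  unfolding hausdorff_def
  by (auto intro!: SUP_least intro: INF_lower2 assms)

section \<open>Estimates for a single metric selection\<close>

context positive_contraction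
begin

text \<open>The first two estimates hold for chain functions with constants independent of k and
  pass to the limit. The second compares the value at \<open>a\<close> with every other value, so
  that it can later be averaged over the interval.\<close>

lemma metric_selection_estimates:
  fixes N :: "real^'d \<Rightarrow> real"
  assumes N: "is_norm N" and F: "F \<in> BV_compact_graph N a b" and s: "s \<in> metric_selections N a b F"
  defines "C \<equiv> 6 + 4 * (\<bar>a\<bar> + \<bar>b\<bar>) + 4 * sqrt (2 * (1 + \<bar>a\<bar> + \<bar>b\<bar>) * (b - a))"
    and "V \<equiv> enn2real (variation N a b F)"
  shows "L1_norm N a b (\<lambda>t. s t - Tv s t) \<le> N (s a) * err (\<lambda>_. 1) + C * l * V"
    and "\<And>t. t \<in> {a..b} \<Longrightarrow> N (s a) \<le> N (s t) + V"
    and "integrable M (\<lambda>t. N (s t))"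
proof -
  obtain n x y where
      *: "\<forall>k. is_partition a b (n k) (x k) \<and> y k \<in> metric_chains N (n k) (\<lambda>i. F (x k i))"
    and lim: "\<forall>t\<in>{a..b}. (\<lambda>k. chain_fun (n k) (x k) (y k) t) \<longlonglongrightarrow> s t"
    using s unfolding metric_selections_def by (elim CollectE conjE exE) (rule that)
  from * have p: "is_partition a b (n k) (x k)"
    and y: "y k \<in> metric_chains N (n k) (\<lambda>i. F (x k i))" for k
    by auto
  define c where "c k t = y k 0 +
    (\<Sum>i<n k. indicator {x k (Suc i)..} t *\<^sub>R (y k (Suc i) - y k i))" for k t
  have c_eq: "chain_fun (n k) (x k) (y k) t = c k t" if "t \<in> {a..b}" for k t
    unfolding c_def by (rule chain_fun_eq_step_fun[OF p that])
  have c_lim: "(\<lambda>k. c k t) \<longlonglongrightarrow> s t" if "t \<in> {a..b}" for t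
    using bspec[OF lim that] c_eq[OF that] by simp
  \<comment> \<open>Compactness of the graph bounds all values of \<open>F\<close> at once;
    \<open>R\<close> is then common to all chain functions.\<close>
  have "bounded (snd ` {(x, y). x \<in> {a..b} \<and> y \<in> F x})"
    using F by (intro bounded_snd compact_imp_bounded) (simp add: BV_compact_graph_def)
  then obtain R where "\<forall>z\<in>snd ` {(x, y). x \<in> {a..b} \<and> y \<in> F x}. norm z \<le> R"
    unfolding bounded_iff by blast
  then have R: "norm v \<le> R" if "t \<in> {a..b}" "v \<in> F t" for t v
    using that by auto
  have n_pos: "0 < n k" for k
    using p[of k] less by (cases "n k") (auto simp: is_partition_def)
  have c_bound: "norm (c k t) \<le> R" if t: "t \<in> {a..b}" for k t
  proof -
    obtain i where "i \<le> n k" "c k t = y k i"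
      using chain_fun_cases[OF p t] c_eq[OF t] by metis
    then show ?thesis
      using R[OF is_partition_in[OF p]] metric_chain_mem[OF y n_pos] by simp
  qed
  have c_meas: "c k \<in> borel_measurable M" for k
    unfolding c_def by (intro borel_measurable_interval) measurable
  have c_int: "integrable M (c k)" for k
    using c_meas c_bound by (rule integrable_bounded_interval)
  have s_meas: "s \<in> borel_measurable M"
    by (rule borel_measurable_LIMSEQ_metric[of c]) (use c_meas c_lim in auto)
  have s_bound: "norm (s t) \<le> R" if "t \<in> {a..b}" for t
    using s R that by (auto simp: metric_selections_def)
  have s_int: "integrable M s"
    using s_meas s_bound by (rule integrable_bounded_interval)
  have V: "(\<Sum>i<n k. N (y k (Suc i) - y k i)) \<le> V" for k
  proof -
    \<comment> \<open>Bounded variation makes the conversion to a real lossless.\<close>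
    have "variation N a b F = ennreal V"
      using F by (simp add: V_def BV_compact_graph_def ennreal_enn2real_if less_top)
    then show ?thesis
      using chain_sum_le_variation[OF N p y, of k] ennreal_le_iff[of V] by (simp add: V_def)
  qed
  \<comment> \<open>All jumps sit at nodes strictly right of \<open>a\<close>, so the value at
    \<open>a\<close> is the constant part of the step function.\<close>
  have c_a: "c k a = y k 0" for k
  proof -
    have "\<not> x k (Suc i) \<le> a" if "i < n k" for i
    proof -
      have "x k 0 < x k (Suc 0)" "x k 0 = a"
        using p[of k] n_pos[of k] by (auto simp: is_partition_def)
      then show ?thesis
        using is_partition_mono[OF p, of "Suc 0" "Suc i" k] that by simp
    qed
    then show ?thesis
      by (simp add: c_def)
  qed
  have N_lim: "(\<lambda>k. N (c k t)) \<longlonglongrightarrow> N (s t)" if "t \<in> {a..b}" for t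
    by (rule continuous_on_tendsto_compose[OF is_norm_continuous[OF N] c_lim[OF that]]) auto
  have a: "a \<in> {a..b}"
    using less by simp
  have C: "0 \<le> C"
    using less by (simp add: C_def)
  show "L1_norm N a b (\<lambda>t. s t - Tv s t) \<le> N (s a) * err (\<lambda>_. 1) + C * l * V"
  proof (rule LIMSEQ_le)
    show "(\<lambda>k. L1_norm N a b (\<lambda>t. c k t - Tv (c k) t)) \<longlonglongrightarrow> L1_norm N a b (\<lambda>t. s t - Tv s t)"
      by (rule L1_norm_diff_Tv_tendsto[OF N c_int s_int c_bound c_lim])
    show "(\<lambda>k. N (c k a) * err (\<lambda>_. 1) + C * l * V) \<longlonglongrightarrow> N (s a) * err (\<lambda>_. 1) + C * l * V"
      by (intro tendsto_intros N_lim a)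
    have "L1_norm N a b (\<lambda>t. c k t - Tv (c k) t) \<le> N (c k a) * err (\<lambda>_. 1) + C * l * V" for k
    proof -
      have "L1_norm N a b (\<lambda>t. c k t - Tv (c k) t) \<le> N (y k 0) * err (\<lambda>_. 1) +
          (\<Sum>i<n k. N (y k (Suc i) - y k i) * err (indicator {x k (Suc i)..}))"
        using integrable_N_diff_Tv[OF N c_int c_bound]
        unfolding c_def by (rule L1_norm_step_fun[OF N])
      also have "(\<Sum>i<n k. N (y k (Suc i) - y k i) * err (indicator {x k (Suc i)..})) \<le>
          (\<Sum>i<n k. N (y k (Suc i) - y k i) * (C * l))"
        unfolding C_def
        by (intro sum_mono mult_left_mono err_step is_partition_in[OF p] is_norm_nonneg[OF N]) auto
      also have "\<dots> = (\<Sum>i<n k. N (y k (Suc i) - y k i)) * (C * l)"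
        by (simp add: sum_distrib_right)
      also have "\<dots> \<le> V * (C * l)"
        using C lam_nonneg by (intro mult_right_mono V) simp
      finally show ?thesis
        by (simp add: c_a mult_ac)
    qed
    then show "\<exists>K. \<forall>k\<ge>K. L1_norm N a b (\<lambda>t. c k t - Tv (c k) t) \<le> N (c k a) * err (\<lambda>_. 1) + C * l * V"
      by blast
  qed
  show "N (s a) \<le> N (s t) + V" if t: "t \<in> {a..b}" for t
  proof (rule LIMSEQ_le)
    show "(\<lambda>k. N (c k a)) \<longlonglongrightarrow> N (s a)"
      by (rule N_lim[OF a])
    show "(\<lambda>k. N (c k t) + V) \<longlonglongrightarrow> N (s t) + V"
      by (intro tendsto_intros N_lim t)
    have "N (c k a) \<le> N (c k t) + V" for k
    proof -
      \<comment> \<open>The jumps made up to \<open>t\<close>: the difference between the values at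
        \<open>t\<close> and at \<open>a\<close>.\<close>
      let ?j = "\<Sum>i<n k. indicator {x k (Suc i)..} t *\<^sub>R (y k (Suc i) - y k i)"
      have "N ?j \<le> (\<Sum>i<n k. N (indicator {x k (Suc i)..} t *\<^sub>R (y k (Suc i) - y k i)))"
        by (rule is_norm_sum[OF N])
      also have "\<dots> \<le> (\<Sum>i<n k. N (y k (Suc i) - y k i))"
        by (intro sum_mono) (auto simp: indicator_def is_normD(1)[OF N] is_norm_nonneg[OF N])
      finally have "N ?j \<le> V"
        using V[of k] by simp
      moreover have "c k a = c k t + - ?j"
        unfolding c_a by (simp add: c_def)
      ultimately show ?thesis
        using is_normD(3)[OF N, of "c k t" "- ?j"] by (simp add: is_norm_minus[OF N])
    qed
    then show "\<exists>K. \<forall>k\<ge>K. N (c k a) \<le> N (c k t) + V"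
      by blast
  qed
  obtain B where B: "\<And>v. norm v \<le> R \<Longrightarrow> N v \<le> B"
    using is_norm_bounded[OF N] by metis
  show "integrable M (\<lambda>t. N (s t))"
  proof (rule integrable_bounded_interval)
    show "(\<lambda>t. N (s t)) \<in> borel_measurable M"
      by (rule measurable_compose[OF s_meas])
         (rule borel_measurable_continuous_onI[OF is_norm_continuous[OF N]])
    show "norm (N (s t)) \<le> B" if "t \<in> {a..b}" for t
      using B s_bound[OF that] by (simp add: is_norm_nonneg[OF N])
  qed
qed

text \<open>Since \<open>sup_norm\<close> is an extended real, the comparison is made with the
  nonnegative integral, where it may stand as a constant integrand.\<close>

lemma L1_norm_le_sup_norm:
  fixes N :: "real^'d \<Rightarrow> real"
  assumes N: "is_norm N" and F: "F \<in> BV_compact_graph N a b" and s: "s \<in> metric_selections N a b F"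
  shows "ennreal (L1_norm N a b s) \<le> sup_norm N a b F * ennreal (b - a)"
proof -
  have "ennreal (L1_norm N a b s) = (\<integral>\<^sup>+t. ennreal (N (s t)) \<partial>M)"
    unfolding L1_norm_eq
    by (rule nn_integral_eq_integral[symmetric])
       (use metric_selection_estimates(3)[OF N F s] in \<open>auto simp: is_norm_nonneg[OF N]\<close>)
  also have "\<dots> \<le> (\<integral>\<^sup>+t. sup_norm N a b F \<partial>M)"
  proof (rule nn_integral_mono)
    fix t assume "t \<in> space M"
    then have t: "t \<in> {a..b}" by simp
    then have "s t \<in> F t"
      using s by (simp add: metric_selections_def)
    then show "ennreal (N (s t)) \<le> sup_norm N a b F"
      unfolding sup_norm_def using norm_le_set_norm[OF N] t by (intro SUP_upper2[of t]) auto
  qed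
  also have "\<dots> = sup_norm N a b F * ennreal (b - a)"
    using less by (simp add: emeasure_restrict_space)
  finally show ?thesis .
qed

end

section \<open>The constants and the Hausdorff bound\<close>

theorem theorem6p5:
  fixes a b :: real and N :: "real^'d \<Rightarrow> real"
  assumes "a < b" and "is_norm N"
  shows "\<exists>C1 C2 :: real. 0 \<le> C1 \<and> 0 \<le> C2 \<and>
    (\<forall>(K :: real \<Rightarrow> real \<Rightarrow> real) (F :: real \<Rightarrow> (real^'d) set).
      continuous_on ({a..b} \<times> {a..b}) (\<lambda>(x, t). K x t) \<longrightarrow>
      positive_op a b (int_op a b K) \<longrightarrow>
      L1_contraction a b (int_op a b K) \<longrightarrow>
      F \<in> BV_compact_graph N a b \<longrightarrow>
      (let S = metric_selections N a b F;
           H = haus_L1 N a b S (int_op_vec a b K ` S);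
           l = lam a b (int_op a b K);
           V = variation N a b F;
           M = ennreal C1 * (ennreal (l\<^sup>2) * (SUP s\<in>S. ennreal (L1_norm N a b s))
                              + 2 * ennreal l * V)
       in H \<le> M \<and>
          M \<le> ennreal C1 * (ennreal (l\<^sup>2) * sup_norm N a b F * ennreal (b - a)
                              + 2 * ennreal l * V) \<and>
          ((\<forall>x\<in>{a..b}. int_op a b K (\<lambda>t. 1) x = 1) \<longrightarrow>
             H \<le> ennreal C2 * ennreal (l\<^sup>2 * (b - a) + 2 * l) * V)))"
proof -
  \<comment> \<open>\<open>L\<close> bounds \<open>l\<close> by \<open>lam_le\<close>, and
    \<open>C\<close> is the constant of \<open>err_step\<close>. In \<open>C1\<close>, the term
    \<open>1 / (b - a)\<close> comes from averaging over the interval, \<open>L\<close> from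
    absorbing a surplus factor \<open>l\<close>, and \<open>C\<close> from the jumps.\<close>
  define L where "L = sqrt (2 * (1 + \<bar>a\<bar> + \<bar>b\<bar>) * (b - a))"
  define C where "C = 6 + 4 * (\<bar>a\<bar> + \<bar>b\<bar>) + 4 * L"
  define C1 where "C1 = 1 / (b - a) + L + C"
  have L: "0 \<le> L" and C: "0 \<le> C"
    using assms(1) by (auto simp: L_def C_def)
  then have C1: "1 / (b - a) \<le> C1" "L + C \<le> C1" "0 \<le> C1"
    using assms(1) by (auto simp: C1_def)
  show ?thesis
    unfolding Let_def
  proof (rule exI[of _ C1], rule exI[of _ C], intro conjI allI impI)
    fix K and F :: "real \<Rightarrow> (real^'d) set"
    assume "continuous_on ({a..b} \<times> {a..b}) (\<lambda>(x, t). K x t)"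
      "positive_op a b (int_op a b K)" "L1_contraction a b (int_op a b K)"
    then interpret positive_contraction a b K
      using assms(1) by unfold_locales
    assume F: "F \<in> BV_compact_graph N a b"
    let ?S = "metric_selections N a b F"
    define V where "V = enn2real (variation N a b F)"
    have V: "variation N a b F = ennreal V" "0 \<le> V"
      using F by (simp_all add: V_def BV_compact_graph_def ennreal_enn2real_if less_top)
    have lV: "0 \<le> l * V"
      using V lam_nonneg by simp
    note est = metric_selection_estimates[OF assms(2) F, folded L_def, folded C_def V_def]
    have "haus_L1 N a b ?S (Tv ` ?S) \<le>
        ennreal C1 * (ennreal (l\<^sup>2) * (SUP s\<in>?S. ennreal (L1_norm N a b s)) + 2 * ennreal l * variation N a b F)"
      unfolding haus_L1_def
    proof (rule hausdorff_image_le)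
      fix s assume s: "s \<in> ?S"
      \<comment> \<open>Averaging over t replaces the point value at \<open>a\<close> by the L1
        norm, at the cost of one variation.\<close>
      have "integral\<^sup>L M (\<lambda>_. N (s a)) \<le> integral\<^sup>L M (\<lambda>t. N (s t) + V)"
        by (rule integral_mono) (use est(2,3)[OF s] integrable_const_interval in auto)
      also have "\<dots> = L1_norm N a b s + V * (b - a)"
        using est(3)[OF s] integrable_const_interval assms(1) by (simp add: L1_norm_eq measure_restrict_space)
      finally have "N (s a) * (b - a) \<le> L1_norm N a b s + V * (b - a)"
        using assms(1) by (simp add: mult.commute)
      then have Nsa: "N (s a) \<le> 1 / (b - a) * L1_norm N a b s + V"
        using assms(1) by (simp add: field_simps)
      have nn: "0 \<le> L1_norm N a b s"
        by (simp add: L1_norm_eq is_norm_nonneg[OF assms(2)])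
      have "L1_norm N a b (\<lambda>t. s t - Tv s t) \<le> N (s a) * err (\<lambda>_. 1) + C * l * V"
        by (rule est(1)[OF s])
      also have "N (s a) * err (\<lambda>_. 1) \<le> (1 / (b - a) * L1_norm N a b s + V) * l\<^sup>2"
        using V nn assms(1) by (intro mult_mono Nsa) (auto simp: lam_sq err_nonneg)
      also have "\<dots> = 1 / (b - a) * (l\<^sup>2 * L1_norm N a b s) + l * (l * V)"
        by (simp add: algebra_simps power2_eq_square)
      \<comment> \<open>The variation produced by averaging carries \<open>l\<^sup>2\<close>; one
        factor is traded for \<open>L\<close>.\<close>
      also have "l * (l * V) \<le> L * (l * V)"
        using lV lam_le by (intro mult_right_mono) (simp_all add: L_def)
      also have "1 / (b - a) * (l\<^sup>2 * L1_norm N a b s) \<le> C1 * (l\<^sup>2 * L1_norm N a b s)"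
        using C1 nn by (intro mult_right_mono) simp_all
      finally have "L1_norm N a b (\<lambda>t. s t - Tv s t) \<le> C1 * (l\<^sup>2 * L1_norm N a b s) + (L + C) * (l * V)"
        by (simp add: algebra_simps)
      \<comment> \<open>The factor 2 is slack: the nonnegative \<open>C1 * (l * V)\<close> is added
        once more.\<close>
      also have "(L + C) * (l * V) \<le> C1 * (2 * l * V)"
        using mult_right_mono[OF C1(2) lV] mult_nonneg_nonneg[OF C1(3) lV] by (simp add: mult_ac)
      finally have "L1_norm N a b (\<lambda>t. s t - Tv s t) \<le> C1 * (l\<^sup>2 * L1_norm N a b s + 2 * l * V)"
        by (simp add: algebra_simps)
      then have "ennreal (L1_norm N a b (\<lambda>t. s t - Tv s t)) \<le> ennreal (C1 * (l\<^sup>2 * L1_norm N a b s + 2 * l * V))"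
        by (rule ennreal_leI)
      also have "\<dots> = ennreal C1 * (ennreal (l\<^sup>2) * ennreal (L1_norm N a b s) + 2 * ennreal l * ennreal V)"
        using C1 nn V lam_nonneg by (simp add: ennreal_mult ennreal_plus)
      also have "\<dots> \<le> ennreal C1 * (ennreal (l\<^sup>2) * (SUP s\<in>?S. ennreal (L1_norm N a b s)) + 2 * ennreal l * variation N a b F)"
        unfolding V(1) using s by (intro mult_left_mono add_right_mono SUP_upper) auto
      finally show "ennreal (L1_norm N a b (\<lambda>t. s t - Tv s t)) \<le> \<dots>" .
    qed
    moreover have "ennreal C1 * (ennreal (l\<^sup>2) * (SUP s\<in>?S. ennreal (L1_norm N a b s)) + 2 * ennreal l * variation N a b F) \<le>
        ennreal C1 * (ennreal (l\<^sup>2) * sup_norm N a b F * ennreal (b - a) + 2 * ennreal l * variation N a b F)"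
      unfolding mult.assoc[of "ennreal (l\<^sup>2)"]
      by (intro mult_left_mono add_right_mono SUP_least L1_norm_le_sup_norm[OF assms(2) F]) auto
    moreover have "haus_L1 N a b ?S (Tv ` ?S) \<le>
        ennreal C * ennreal (l\<^sup>2 * (b - a) + 2 * l) * variation N a b F"
      if one: "\<forall>x\<in>{a..b}. T (\<lambda>t. 1) x = 1"
      unfolding haus_L1_def
    proof (rule hausdorff_image_le)
      fix s assume s: "s \<in> ?S"
      \<comment> \<open>When constants are reproduced, the value at \<open>a\<close> contributes no
        error and only the jump term remains.\<close>
      have "err (\<lambda>_. 1) = nrm (\<lambda>_. 0)"
        unfolding err_def by (rule L1_norm_cong) (use one in simp)
      then have "L1_norm N a b (\<lambda>t. s t - Tv s t) \<le> C * l * V"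
        using est(1)[OF s] by (simp add: L1_norm_eq)
      also have "\<dots> \<le> C * (l\<^sup>2 * (b - a) + 2 * l) * V"
        using C V lam_nonneg assms(1) by (intro mult_right_mono mult_left_mono) auto
      finally have "ennreal (L1_norm N a b (\<lambda>t. s t - Tv s t)) \<le> ennreal (C * (l\<^sup>2 * (b - a) + 2 * l) * V)"
        by (rule ennreal_leI)
      also have "\<dots> = ennreal C * ennreal (l\<^sup>2 * (b - a) + 2 * l) * variation N a b F"
        unfolding V(1) using C V lam_nonneg assms(1) by (simp add: ennreal_mult)
      finally show "ennreal (L1_norm N a b (\<lambda>t. s t - Tv s t)) \<le> \<dots>" .
    qed
    ultimately show "haus_L1 N a b ?S (Tv ` ?S) \<le>
        ennreal C1 * (ennreal (l\<^sup>2) * (SUP s\<in>?S. ennreal (L1_norm N a b s)) + 2 * ennreal l * variation N a b F)"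
      "ennreal C1 * (ennreal (l\<^sup>2) * (SUP s\<in>?S. ennreal (L1_norm N a b s)) + 2 * ennreal l * variation N a b F) \<le>
        ennreal C1 * (ennreal (l\<^sup>2) * sup_norm N a b F * ennreal (b - a) + 2 * ennreal l * variation N a b F)"
      "\<forall>x\<in>{a..b}. T (\<lambda>t. 1) x = 1 \<Longrightarrow> haus_L1 N a b ?S (Tv ` ?S) \<le>
        ennreal C * ennreal (l\<^sup>2 * (b - a) + 2 * l) * variation N a b F"
      by blast+
  qed (use C C1 in auto)
qed

end
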